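(* There is an isomorphism of categories between the category of modules over a unitary ring with $\tfrac12$ and the category of pointed affine mobi spaces over a mobi algebra with $2$.
   Context: A mobi algebra is a system $(A,p,0,\tfrac12,1)$ consisting of a set $A$, a ternary operation $p\colon A^3\to A$ and three constants $0,\tfrac12,1\in A$ such that for all elements of $A$: (A1) $p(1,\tfrac12,0)=\tfrac12$; (A2) $p(0,a,1)=a$; (A3) $p(a,b,a)=a$; (A4) $p(a,0,b)=a$; (A5) $p(b,1,a)=a$; (A6) $p(a,\tfrac12,b)=p(a,\tfrac12,c)\Rightarrow b=c$; (A7) $p(a,p(b_1,b_2,b_3),c)=p(p(a,b_1,c),b_2,p(a,b_3,c))$; (A8) $p(p(a_1,b,c_1),\tfrac12,p(a_2,b,c_2))=p(p(a_1,\tfrac12,a_2),b,p(c_1,\tfrac12,c_2))$. A morphism of mobi algebras $(A,p,0,\tfrac12,1)\to(A',p',0,\tfrac12,1)$ is a map $f\colon A\to A'$ with $f(0)=0$, $f(\tfrac12)=\tfrac12$, $f(1)=1$ and $f(p(a,b,c))=p'(f(a),f(b),f(c))$ for all $a,b,c\in A$. A mobi algebra "with $2$" is one containing an element $2$ such that $p(0,\tfrac12,2)=1$. An $A$-mobi space over a mobi algebra $A$ is a pair $(X,q)$ with $X$ a set and $q\colon X\times A\times X\to X$ a map such that for all elements: (X1) $q(x,0,y)=x$; (X2) $q(y,1,x)=x$; (X3) $q(x,a,x)=x$; (X4) $q(x,\tfrac12,y)=q(x,\tfrac12,y')\Rightarrow y=y'$; (X5) $q(q(x,a,y),b,q(x,c,y))=q(x,p(a,b,c),y)$.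 It is affine if $q(q(x_1,a,y_1),\tfrac12,q(x_2,a,y_2))=q(q(x_1,\tfrac12,x_2),a,q(y_1,\tfrac12,y_2))$ for all $x_1,x_2,y_1,y_2\in X$, $a\in A$. The category of pointed affine mobi spaces over a mobi algebra with $2$: objects are pairs $(A,X_A)$ in which $A$ is a mobi algebra with $2$ and $X_A=(X,q,e)$ is an affine $A$-mobi space $(X,q)$ together with an element $e\in X$ (its origin). Morphisms $(A,(X,q,e))\to(A',(X',q',e))$ are pairs $(f,g)$ with $f\colon A\to A'$ a morphism of mobi algebras and $g\colon X\to X'$ a map such that $g(e)=e$ and $g(q(x,a,y))=q'(g(x),f(a),g(y))$ for all $x,y\in X$, $a\in A$. The category of modules over a ring with $\tfrac12$: objects are pairs $(R,X_R)$ in which $R$ is a unitary (not necessarily commutative) ring in which $2=1+1$ has an inverse $\tfrac12$, and $X_R=(X,+,e,\varphi)$ is a module over $R$, i.e. $(X,+,e)$ is an abelian group with identity $e$ and $\varphi\colon R\to\mathrm{End}(X)$, $a\mapsto\varphi_a$, is a homomorphism of unitary rings. Morphisms $(R,X_R)\to(R',X'_{R'})$ are pairs $(f,g)$ with $f\colon R\to R'$ a homomorphism of unitary rings and $g\colon X\to X'$ a map such that $g(e)=e$, $g(x+y)=g(x)+g(y)$ and $g(\varphi_a(x))=\varphi_{f(a)}(g(x))$ for all $x,y\in X$, $a\in R$. *)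

theory Defs
  imports "HOL-Algebra.Ring"
begin

text \<open>
  Categories in arrow-based form. Only values on objects, arrows and composable pairs are
  relevant; \<open>Comp C g f\<close> is \<open>g\<close> after \<open>f\<close>.
\<close>

record ('o, 'm) category_data =
  Ob :: "'o set"
  Ar :: "'m set"
  Dom :: "'m \<Rightarrow> 'o"
  Cod :: "'m \<Rightarrow> 'o"
  Ident :: "'o \<Rightarrow> 'm"
  Comp :: "'m \<Rightarrow> 'm \<Rightarrow> 'm"

locale category =
  fixes C :: "('o, 'm) category_data"
  assumes Dom_Ob: "f \<in> Ar C \<Longrightarrow> Dom C f \<in> Ob C"
    and Cod_Ob: "f \<in> Ar C \<Longrightarrow> Cod C f \<in> Ob C"
    and Ident_Ar: "X \<in> Ob C \<Longrightarrow> Ident C X \<in> Ar C"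
    and Dom_Ident: "X \<in> Ob C \<Longrightarrow> Dom C (Ident C X) = X"
    and Cod_Ident: "X \<in> Ob C \<Longrightarrow> Cod C (Ident C X) = X"
    and Comp_Ar: "\<lbrakk>f \<in> Ar C; g \<in> Ar C; Cod C f = Dom C g\<rbrakk> \<Longrightarrow> Comp C g f \<in> Ar C"
    and Dom_Comp: "\<lbrakk>f \<in> Ar C; g \<in> Ar C; Cod C f = Dom C g\<rbrakk> \<Longrightarrow> Dom C (Comp C g f) = Dom C f"
    and Cod_Comp: "\<lbrakk>f \<in> Ar C; g \<in> Ar C; Cod C f = Dom C g\<rbrakk> \<Longrightarrow> Cod C (Comp C g f) = Cod C g"
    and Comp_Ident_right: "f \<in> Ar C \<Longrightarrow> Comp C f (Ident C (Dom C f)) = f"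
    and Comp_Ident_left: "f \<in> Ar C \<Longrightarrow> Comp C (Ident C (Cod C f)) f = f"
    and Comp_assoc: "\<lbrakk>f \<in> Ar C; g \<in> Ar C; h \<in> Ar C; Cod C f = Dom C g; Cod C g = Dom C h\<rbrakk>
      \<Longrightarrow> Comp C (Comp C h g) f = Comp C h (Comp C g f)"

locale cat_functor =
  source: category C + target: category D
  for C :: "('o, 'm) category_data" and D :: "('p, 'n) category_data" +
  fixes Fo :: "'o \<Rightarrow> 'p" and Fa :: "'m \<Rightarrow> 'n"
  assumes Fo_Ob: "X \<in> Ob C \<Longrightarrow> Fo X \<in> Ob D"
    and Fa_Ar: "f \<in> Ar C \<Longrightarrow> Fa f \<in> Ar D"
    and Dom_Fa: "f \<in> Ar C \<Longrightarrow> Dom D (Fa f) = Fo (Dom C f)"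
    and Cod_Fa: "f \<in> Ar C \<Longrightarrow> Cod D (Fa f) = Fo (Cod C f)"
    and Fa_Ident: "X \<in> Ob C \<Longrightarrow> Fa (Ident C X) = Ident D (Fo X)"
    and Fa_Comp: "\<lbrakk>f \<in> Ar C; g \<in> Ar C; Cod C f = Dom C g\<rbrakk>
      \<Longrightarrow> Fa (Comp C g f) = Comp D (Fa g) (Fa f)"

definition isomorphic_categories ::
    "('o, 'm) category_data \<Rightarrow> ('p, 'n) category_data \<Rightarrow> bool" where
  "isomorphic_categories C D \<longleftrightarrow> category C \<and> category D \<and>
    (\<exists>Fo Fa Go Ga. cat_functor C D Fo Fa \<and> cat_functor D C Go Ga \<and>
      (\<forall>X\<in>Ob C. Go (Fo X) = X) \<and> (\<forall>f\<in>Ar C. Ga (Fa f) = f) \<and>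
      (\<forall>Y\<in>Ob D. Fo (Go Y) = Y) \<and> (\<forall>g\<in>Ar D. Fa (Ga g) = g))"

text \<open>
  Both categories below have as objects pairs of structures with carrier sets and as morphisms
  pairs of maps between these carriers. Source and target are part of an arrow. Since an
  isomorphism of categories concerns equality of objects and of arrows, every map defined on
  a set is represented by the HOL function that takes the value \<open>undefined\<close> off that set.
\<close>

datatype ('o, 'f) arrow = Arrow (src: 'o) (tgt: 'o) (maps: 'f)

definition pair_category ::
    "(('a, 'r) partial_object_scheme \<times> ('x, 's) partial_object_scheme) set
      \<Rightarrow> (('a, 'r) partial_object_scheme \<times> ('x, 's) partial_object_scheme
           \<Rightarrow> ('a, 'r) partial_object_scheme \<times> ('x, 's) partial_object_scheme
           \<Rightarrow> (('a \<Rightarrow> 'a) \<times> ('x \<Rightarrow> 'x)) set)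
      \<Rightarrow> (('a, 'r) partial_object_scheme \<times> ('x, 's) partial_object_scheme,
          (('a, 'r) partial_object_scheme \<times> ('x, 's) partial_object_scheme,
           ('a \<Rightarrow> 'a) \<times> ('x \<Rightarrow> 'x)) arrow) category_data" where
  "pair_category O\<^sub>C Hom\<^sub>C = \<lparr>
     Ob = O\<^sub>C,
     Ar = {h. src h \<in> O\<^sub>C \<and> tgt h \<in> O\<^sub>C \<and> maps h \<in> Hom\<^sub>C (src h) (tgt h)},
     Dom = src,
     Cod = tgt,
     Ident = (\<lambda>S. Arrow S S (\<lambda>a\<in>carrier (fst S). a, \<lambda>x\<in>carrier (snd S). x)),
     Comp = (\<lambda>k h. Arrow (src h) (tgt k)
       (compose (carrier (fst (src h))) (fst (maps k)) (fst (maps h)),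
        compose (carrier (snd (src h))) (snd (maps k)) (snd (maps h))))\<rparr>"

definition extensional2 :: "'a set \<Rightarrow> 'b set \<Rightarrow> ('a \<Rightarrow> 'b \<Rightarrow> 'c) \<Rightarrow> bool" where
  "extensional2 A B f \<longleftrightarrow> (\<forall>a b. \<not> (a \<in> A \<and> b \<in> B) \<longrightarrow> f a b = undefined)"

definition extensional3 :: "'a set \<Rightarrow> 'b set \<Rightarrow> 'c set \<Rightarrow> ('a \<Rightarrow> 'b \<Rightarrow> 'c \<Rightarrow> 'd) \<Rightarrow> bool" where
  "extensional3 A B C f \<longleftrightarrow> (\<forall>a b c. \<not> (a \<in> A \<and> b \<in> B \<and> c \<in> C) \<longrightarrow> f a b c = undefined)"


text \<open>
  Modules over not necessarily commutative unitary rings (the library's modules are over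
  commutative rings). A module \<open>(X, +, e, \<phi>)\<close> extends the library's monoid record, whose
  multiplication \<open>\<otimes>\<close> plays the role of \<open>+\<close> and whose unit \<open>\<one>\<close> that of \<open>e\<close>.
\<close>

record ('a, 'x) rmodule = "'x monoid" +
  act :: "'a \<Rightarrow> 'x \<Rightarrow> 'x"

definition End_ring :: "('x, 'm) monoid_scheme \<Rightarrow> ('x \<Rightarrow> 'x) ring" where
  "End_ring X = \<lparr>
     carrier = hom X X \<inter> extensional (carrier X),
     monoid.mult = (\<lambda>f g. compose (carrier X) f g),
     one = (\<lambda>x\<in>carrier X. x),
     zero = (\<lambda>x\<in>carrier X. \<one>\<^bsub>X\<^esub>),
     add = (\<lambda>f g. \<lambda>x\<in>carrier X. f x \<otimes>\<^bsub>X\<^esub> g x)\<rparr>"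

locale ring_with_half = ring R for R (structure) +
  assumes two_invertible: "\<one> \<oplus> \<one> \<in> Units R"

locale ring_module = ring R + comm_group X
  for R :: "('a, 'r) ring_scheme" and X :: "('a, 'x, 's) rmodule_scheme" +
  assumes act_ring_hom: "act X \<in> ring_hom R (End_ring X)"

definition module_objects :: "('a ring \<times> ('a, 'x) rmodule) set" where
  "module_objects = {(R, X). ring_with_half R \<and> ring_module R X \<and>
     extensional2 (carrier R) (carrier R) (monoid.mult R) \<and>
     extensional2 (carrier R) (carrier R) (add R) \<and>
     extensional2 (carrier X) (carrier X) (monoid.mult X) \<and>
     act X \<in> extensional (carrier R)}"

definition module_hom ::
    "'a ring \<times> ('a, 'x) rmodule \<Rightarrow> 'a ring \<times> ('a, 'x) rmodule \<Rightarrow> (('a \<Rightarrow> 'a) \<times> ('x \<Rightarrow> 'x)) set" where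
  "module_hom = (\<lambda>(R, X) (R', X').
     {(f, g). f \<in> ring_hom R R' \<and> f \<in> extensional (carrier R) \<and>
       g \<in> carrier X \<rightarrow>\<^sub>E carrier X' \<and>
       g \<one>\<^bsub>X\<^esub> = \<one>\<^bsub>X'\<^esub> \<and>
       (\<forall>x\<in>carrier X. \<forall>y\<in>carrier X. g (x \<otimes>\<^bsub>X\<^esub> y) = g x \<otimes>\<^bsub>X'\<^esub> g y) \<and>
       (\<forall>a\<in>carrier R. \<forall>x\<in>carrier X. g (act X a x) = act X' (f a) (g x))})"

definition module_category where
  "module_category = pair_category module_objects module_hom"


record 'a mobi_algebra = "'a partial_object" +
  mop :: "'a \<Rightarrow> 'a \<Rightarrow> 'a \<Rightarrow> 'a"
  mzero :: 'a
  mhalf :: 'a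
  mone :: 'a

locale mobi_algebra =
  fixes A :: "('a, 'r) mobi_algebra_scheme"
  assumes mop_closed:
      "\<lbrakk>a \<in> carrier A; b \<in> carrier A; c \<in> carrier A\<rbrakk> \<Longrightarrow> mop A a b c \<in> carrier A"
    and mzero_closed: "mzero A \<in> carrier A"
    and mhalf_closed: "mhalf A \<in> carrier A"
    and mone_closed: "mone A \<in> carrier A"
    and A1: "mop A (mone A) (mhalf A) (mzero A) = mhalf A"
    and A2: "a \<in> carrier A \<Longrightarrow> mop A (mzero A) a (mone A) = a"
    and A3: "\<lbrakk>a \<in> carrier A; b \<in> carrier A\<rbrakk> \<Longrightarrow> mop A a b a = a"
    and A4: "\<lbrakk>a \<in> carrier A; b \<in> carrier A\<rbrakk> \<Longrightarrow> mop A a (mzero A) b = a"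
    and A5: "\<lbrakk>a \<in> carrier A; b \<in> carrier A\<rbrakk> \<Longrightarrow> mop A b (mone A) a = a"
    and A6: "\<lbrakk>a \<in> carrier A; b \<in> carrier A; c \<in> carrier A;
        mop A a (mhalf A) b = mop A a (mhalf A) c\<rbrakk> \<Longrightarrow> b = c"
    and A7: "\<lbrakk>a \<in> carrier A; b\<^sub>1 \<in> carrier A; b\<^sub>2 \<in> carrier A; b\<^sub>3 \<in> carrier A; c \<in> carrier A\<rbrakk>
      \<Longrightarrow> mop A a (mop A b\<^sub>1 b\<^sub>2 b\<^sub>3) c = mop A (mop A a b\<^sub>1 c) b\<^sub>2 (mop A a b\<^sub>3 c)"
    and A8: "\<lbrakk>a\<^sub>1 \<in> carrier A; a\<^sub>2 \<in> carrier A; b \<in> carrier A; c\<^sub>1 \<in> carrier A; c\<^sub>2 \<in> carrier A\<rbrakk>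
      \<Longrightarrow> mop A (mop A a\<^sub>1 b c\<^sub>1) (mhalf A) (mop A a\<^sub>2 b c\<^sub>2)
        = mop A (mop A a\<^sub>1 (mhalf A) a\<^sub>2) b (mop A c\<^sub>1 (mhalf A) c\<^sub>2)"

locale mobi_algebra_with_two = mobi_algebra +
  assumes ex_two: "\<exists>t\<in>carrier A. mop A (mzero A) (mhalf A) t = mone A"

definition mobi_algebra_hom ::
    "('a, 'r) mobi_algebra_scheme \<Rightarrow> ('b, 's) mobi_algebra_scheme \<Rightarrow> ('a \<Rightarrow> 'b) set" where
  "mobi_algebra_hom A A' = {f \<in> carrier A \<rightarrow> carrier A'.
     f (mzero A) = mzero A' \<and> f (mhalf A) = mhalf A' \<and> f (mone A) = mone A' \<and>
     (\<forall>a\<in>carrier A. \<forall>b\<in>carrier A. \<forall>c\<in>carrier A. f (mop A a b c) = mop A' (f a) (f b) (f c))}"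

record ('a, 'x) mobi_space = "'x partial_object" +
  sop :: "'x \<Rightarrow> 'a \<Rightarrow> 'x \<Rightarrow> 'x"

record ('a, 'x) pointed_mobi_space = "('a, 'x) mobi_space" +
  origin :: 'x

locale mobi_space = mobi_algebra A
  for A :: "('a, 'r) mobi_algebra_scheme" +
  fixes X :: "('a, 'x, 's) mobi_space_scheme"
  assumes sop_closed:
      "\<lbrakk>x \<in> carrier X; a \<in> carrier A; y \<in> carrier X\<rbrakk> \<Longrightarrow> sop X x a y \<in> carrier X"
    and X1: "\<lbrakk>x \<in> carrier X; y \<in> carrier X\<rbrakk> \<Longrightarrow> sop X x (mzero A) y = x"
    and X2: "\<lbrakk>x \<in> carrier X; y \<in> carrier X\<rbrakk> \<Longrightarrow> sop X y (mone A) x = x"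
    and X3: "\<lbrakk>x \<in> carrier X; a \<in> carrier A\<rbrakk> \<Longrightarrow> sop X x a x = x"
    and X4: "\<lbrakk>x \<in> carrier X; y \<in> carrier X; y' \<in> carrier X;
        sop X x (mhalf A) y = sop X x (mhalf A) y'\<rbrakk> \<Longrightarrow> y = y'"
    and X5: "\<lbrakk>x \<in> carrier X; y \<in> carrier X; a \<in> carrier A; b \<in> carrier A; c \<in> carrier A\<rbrakk>
      \<Longrightarrow> sop X (sop X x a y) b (sop X x c y) = sop X x (mop A a b c) y"

locale affine_mobi_space = mobi_space +
  assumes affine: "\<lbrakk>x\<^sub>1 \<in> carrier X; x\<^sub>2 \<in> carrier X; y\<^sub>1 \<in> carrier X; y\<^sub>2 \<in> carrier X; a \<in> carrier A\<rbrakk>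
      \<Longrightarrow> sop X (sop X x\<^sub>1 a y\<^sub>1) (mhalf A) (sop X x\<^sub>2 a y\<^sub>2)
        = sop X (sop X x\<^sub>1 (mhalf A) x\<^sub>2) a (sop X y\<^sub>1 (mhalf A) y\<^sub>2)"

definition pointed_affine_mobi_objects :: "('a mobi_algebra \<times> ('a, 'x) pointed_mobi_space) set" where
  "pointed_affine_mobi_objects = {(A, X). mobi_algebra_with_two A \<and> affine_mobi_space A X \<and>
     origin X \<in> carrier X \<and>
     extensional3 (carrier A) (carrier A) (carrier A) (mop A) \<and>
     extensional3 (carrier X) (carrier A) (carrier X) (sop X)}"

definition pointed_affine_mobi_hom ::
    "'a mobi_algebra \<times> ('a, 'x) pointed_mobi_space \<Rightarrow> 'a mobi_algebra \<times> ('a, 'x) pointed_mobi_space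
      \<Rightarrow> (('a \<Rightarrow> 'a) \<times> ('x \<Rightarrow> 'x)) set" where
  "pointed_affine_mobi_hom = (\<lambda>(A, X) (A', X').
     {(f, g). f \<in> mobi_algebra_hom A A' \<and> f \<in> extensional (carrier A) \<and>
       g \<in> carrier X \<rightarrow>\<^sub>E carrier X' \<and>
       g (origin X) = origin X' \<and>
       (\<forall>x\<in>carrier X. \<forall>a\<in>carrier A. \<forall>y\<in>carrier X.
         g (sop X x a y) = sop X' (g x) (f a) (g y))})"

definition pointed_affine_mobi_category where
  "pointed_affine_mobi_category = pair_category pointed_affine_mobi_objects pointed_affine_mobi_hom"

end

theory Submission imports Defs begin

text \<open>
  A module is turned into a mobi space by \<open>q(x, a, y) = (1 - a) x + a y\<close>. Conversely a pointed
  affine mobi space carries the scalar action \<open>a x = q(e, a, x)\<close> and the addition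
  \<open>x + y = 2 q(x, 1/2, y)\<close>; since \<open>1/2\<close> acts injectively with inverse \<open>2\<close>, the module laws
  reduce to identities between midpoints, which follow from affineness and (X5). The two passages
  are inverse to each other because \<open>q(x, a, e)\<close> and \<open>q(e, a, y)\<close> have the same midpoint as
  \<open>e\<close> and \<open>q(x, a, y)\<close>.

  A ring is a module over itself, and (A3)--(A8) say that a mobi algebra is an affine mobi space
  over itself with origin \<open>0\<close>, so the correspondence between rings and mobi algebras is the
  regular case of the one between modules and spaces.
\<close>

section \<open>Isomorphic categories of pairs of structures\<close>

lemma pair_category_simps [simp]:
  "Ob (pair_category O\<^sub>C Hom\<^sub>C) = O\<^sub>C"
  "h \<in> Ar (pair_category O\<^sub>C Hom\<^sub>C) \<longleftrightarrow>
    src h \<in> O\<^sub>C \<and> tgt h \<in> O\<^sub>C \<and> maps h \<in> Hom\<^sub>C (src h) (tgt h)"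
  "Dom (pair_category O\<^sub>C Hom\<^sub>C) = src"
  "Cod (pair_category O\<^sub>C Hom\<^sub>C) = tgt"
  "Ident (pair_category O\<^sub>C Hom\<^sub>C) S = Arrow S S (\<lambda>a\<in>carrier (fst S). a, \<lambda>x\<in>carrier (snd S). x)"
  "Comp (pair_category O\<^sub>C Hom\<^sub>C) k h = Arrow (src h) (tgt k)
       (compose (carrier (fst (src h))) (fst (maps k)) (fst (maps h)),
        compose (carrier (snd (src h))) (snd (maps k)) (snd (maps h)))"
  by (simp_all add: pair_category_def)

lemma compose_assoc_on:
  assumes "f \<in> A \<rightarrow> B"
  shows "compose A (compose B h g) f = compose A h (compose A g f)"
  using assms by (auto simp: compose_def fun_eq_iff Pi_iff)

text \<open>Homs are extensional maps, so composing with a restricted identity returns the very same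
  HOL function. Associativity holds because the first map lands in the carrier to which the inner
  composite is restricted.\<close>

lemma category_pair_category:
  assumes maps: "\<And>S T f g. \<lbrakk>S \<in> O\<^sub>C; T \<in> O\<^sub>C; (f, g) \<in> Hom\<^sub>C S T\<rbrakk> \<Longrightarrow>
      f \<in> carrier (fst S) \<rightarrow>\<^sub>E carrier (fst T) \<and> g \<in> carrier (snd S) \<rightarrow>\<^sub>E carrier (snd T)"
    and ident: "\<And>S. S \<in> O\<^sub>C \<Longrightarrow>
      (\<lambda>a\<in>carrier (fst S). a, \<lambda>x\<in>carrier (snd S). x) \<in> Hom\<^sub>C S S"
    and comp: "\<And>S T U f g f' g'. \<lbrakk>S \<in> O\<^sub>C; T \<in> O\<^sub>C; U \<in> O\<^sub>C;
        (f, g) \<in> Hom\<^sub>C S T; (f', g') \<in> Hom\<^sub>C T U\<rbrakk> \<Longrightarrow>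
      (compose (carrier (fst S)) f' f, compose (carrier (snd S)) g' g) \<in> Hom\<^sub>C S U"
  shows "category (pair_category O\<^sub>C Hom\<^sub>C)"
proof -
  have m: "fst (maps h) \<in> carrier (fst (src h)) \<rightarrow>\<^sub>E carrier (fst (tgt h))
      \<and> snd (maps h) \<in> carrier (snd (src h)) \<rightarrow>\<^sub>E carrier (snd (tgt h))"
    if "h \<in> Ar (pair_category O\<^sub>C Hom\<^sub>C)" for h
    using that maps[of "src h" "tgt h" "fst (maps h)" "snd (maps h)"] by simp
  show ?thesis
  proof
    fix f
    assume f: "f \<in> Ar (pair_category O\<^sub>C Hom\<^sub>C)"
    note mf = m[OF f]
    show "Comp (pair_category O\<^sub>C Hom\<^sub>C) f (Ident (pair_category O\<^sub>C Hom\<^sub>C) (Dom (pair_category O\<^sub>C Hom\<^sub>C) f)) = f"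
      using mf by (cases f; cases "maps f")
        (auto simp: compose_def fun_eq_iff PiE_iff extensional_def)
    show "Comp (pair_category O\<^sub>C Hom\<^sub>C) (Ident (pair_category O\<^sub>C Hom\<^sub>C) (Cod (pair_category O\<^sub>C Hom\<^sub>C) f)) f = f"
      using mf by (cases f; cases "maps f")
        (auto simp: compose_def fun_eq_iff PiE_iff extensional_def)
  next
    fix f g h
    assume "f \<in> Ar (pair_category O\<^sub>C Hom\<^sub>C)" "g \<in> Ar (pair_category O\<^sub>C Hom\<^sub>C)"
      "h \<in> Ar (pair_category O\<^sub>C Hom\<^sub>C)"
      "Cod (pair_category O\<^sub>C Hom\<^sub>C) f = Dom (pair_category O\<^sub>C Hom\<^sub>C) g"
      "Cod (pair_category O\<^sub>C Hom\<^sub>C) g = Dom (pair_category O\<^sub>C Hom\<^sub>C) h"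
    then show "Comp (pair_category O\<^sub>C Hom\<^sub>C) (Comp (pair_category O\<^sub>C Hom\<^sub>C) h g) f =
        Comp (pair_category O\<^sub>C Hom\<^sub>C) h (Comp (pair_category O\<^sub>C Hom\<^sub>C) g f)"
      using m[of f] by (auto simp: PiE_iff intro!: compose_assoc_on)
  next
    fix f g
    assume "f \<in> Ar (pair_category O\<^sub>C Hom\<^sub>C)" "g \<in> Ar (pair_category O\<^sub>C Hom\<^sub>C)"
      "Cod (pair_category O\<^sub>C Hom\<^sub>C) f = Dom (pair_category O\<^sub>C Hom\<^sub>C) g"
    then show "Comp (pair_category O\<^sub>C Hom\<^sub>C) g f \<in> Ar (pair_category O\<^sub>C Hom\<^sub>C)"
      using comp[of "src f" "tgt f" "tgt g" "fst (maps f)" "snd (maps f)"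
          "fst (maps g)" "snd (maps g)"] by simp
  qed (use ident in auto)
qed

text \<open>Arrows keep their maps and get new endpoints. Identities and composites depend on the
  structures through their carriers alone, and \<open>F\<close> keeps the carriers, so functoriality
  reduces to the inclusion of hom sets.\<close>

lemma cat_functor_pair_category:
  fixes F
  assumes "category (pair_category O\<^sub>C Hom\<^sub>C)" "category (pair_category O\<^sub>D Hom\<^sub>D)"
    and "\<And>S. S \<in> O\<^sub>C \<Longrightarrow> F S \<in> O\<^sub>D"
    and "\<And>S. S \<in> O\<^sub>C \<Longrightarrow> carrier (fst (F S)) = carrier (fst S)"
    and "\<And>S. S \<in> O\<^sub>C \<Longrightarrow> carrier (snd (F S)) = carrier (snd S)"
    and "\<And>S T. \<lbrakk>S \<in> O\<^sub>C; T \<in> O\<^sub>C\<rbrakk> \<Longrightarrow> Hom\<^sub>C S T \<subseteq> Hom\<^sub>D (F S) (F T)"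
  shows "cat_functor (pair_category O\<^sub>C Hom\<^sub>C) (pair_category O\<^sub>D Hom\<^sub>D) F
    (\<lambda>h. Arrow (F (src h)) (F (tgt h)) (maps h))"
  unfolding cat_functor_def cat_functor_axioms_def using assms by (simp add: subset_eq)

text \<open>Since the arrow maps only relabel source and target, they are mutually inverse as soon
  as \<open>F\<close> and \<open>G\<close> are mutually inverse on objects. The two opposite
  inclusions of hom sets make both assignments functors.\<close>

lemma isomorphic_pair_categories:
  fixes F G
  assumes "category (pair_category O\<^sub>C Hom\<^sub>C)" "category (pair_category O\<^sub>D Hom\<^sub>D)"
    and F: "\<And>S. S \<in> O\<^sub>C \<Longrightarrow> F S \<in> O\<^sub>D"
      "\<And>S. S \<in> O\<^sub>C \<Longrightarrow> carrier (fst (F S)) = carrier (fst S)"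
      "\<And>S. S \<in> O\<^sub>C \<Longrightarrow> carrier (snd (F S)) = carrier (snd S)"
      "\<And>S T. \<lbrakk>S \<in> O\<^sub>C; T \<in> O\<^sub>C\<rbrakk> \<Longrightarrow> Hom\<^sub>C S T \<subseteq> Hom\<^sub>D (F S) (F T)"
    and G: "\<And>S. S \<in> O\<^sub>D \<Longrightarrow> G S \<in> O\<^sub>C"
      "\<And>S. S \<in> O\<^sub>D \<Longrightarrow> carrier (fst (G S)) = carrier (fst S)"
      "\<And>S. S \<in> O\<^sub>D \<Longrightarrow> carrier (snd (G S)) = carrier (snd S)"
      "\<And>S T. \<lbrakk>S \<in> O\<^sub>D; T \<in> O\<^sub>D\<rbrakk> \<Longrightarrow> Hom\<^sub>D S T \<subseteq> Hom\<^sub>C (G S) (G T)"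
    and GF: "\<And>S. S \<in> O\<^sub>C \<Longrightarrow> G (F S) = S"
    and FG: "\<And>S. S \<in> O\<^sub>D \<Longrightarrow> F (G S) = S"
  shows "isomorphic_categories (pair_category O\<^sub>C Hom\<^sub>C) (pair_category O\<^sub>D Hom\<^sub>D)"
  unfolding isomorphic_categories_def
proof (intro conjI exI)
  show "cat_functor (pair_category O\<^sub>C Hom\<^sub>C) (pair_category O\<^sub>D Hom\<^sub>D) F
    (\<lambda>h. Arrow (F (src h)) (F (tgt h)) (maps h))"
    by (rule cat_functor_pair_category) (use assms in auto)
  show "cat_functor (pair_category O\<^sub>D Hom\<^sub>D) (pair_category O\<^sub>C Hom\<^sub>C) G
    (\<lambda>h. Arrow (G (src h)) (G (tgt h)) (maps h))"
    by (rule cat_functor_pair_category) (use assms in auto)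
qed (use assms in auto)

section \<open>Modules and pointed affine mobi spaces form categories\<close>

lemma (in ring_module) act_closed [simp]:
  "\<lbrakk>a \<in> carrier R; x \<in> carrier X\<rbrakk> \<Longrightarrow> act X a x \<in> carrier X"
  using act_ring_hom by (auto simp: ring_hom_def End_ring_def hom_def Pi_iff)

lemma pair_category_module: "category (pair_category module_objects module_hom)"
proof (rule category_pair_category)
  fix S T :: "'a ring \<times> ('a, 'b) rmodule" and f g
  assume "(f, g) \<in> module_hom S T"
  then show "f \<in> carrier (fst S) \<rightarrow>\<^sub>E carrier (fst T) \<and> g \<in> carrier (snd S) \<rightarrow>\<^sub>E carrier (snd T)"
    by (cases S; cases T) (auto simp: module_hom_def ring_hom_def PiE_def)
next
  fix S :: "'a ring \<times> ('a, 'b) rmodule"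
  assume "S \<in> module_objects"
  moreover obtain R X where S: "S = (R, X)"
    by (cases S)
  ultimately interpret ring_module R X
    by (simp add: module_objects_def)
  show "(\<lambda>a\<in>carrier (fst S). a, \<lambda>x\<in>carrier (snd S). x) \<in> module_hom S S"
    by (auto simp: module_hom_def ring_hom_def S)
next
  fix S T U :: "'a ring \<times> ('a, 'b) rmodule" and f g f' g'
  assume ob: "S \<in> module_objects"
    and fg: "(f, g) \<in> module_hom S T" and fg': "(f', g') \<in> module_hom T U"
  obtain R X R1 X1 R2 X2 where S: "S = (R, X)" "T = (R1, X1)" "U = (R2, X2)"
    by (metis surj_pair)
  then interpret ring_module R X
    using ob by (simp add: module_objects_def)
  \<comment> \<open>Closure of the operations of the source is what allows the restricted composite
    to be evaluated at sums and scalar multiples.\<close>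
  show "(compose (carrier (fst S)) f' f, compose (carrier (snd S)) g' g) \<in> module_hom S U"
    using fg fg' by (simp add: module_hom_def ring_hom_def S Pi_iff PiE_iff compose_def)
qed

lemma pair_category_pointed_affine_mobi:
  "category (pair_category pointed_affine_mobi_objects pointed_affine_mobi_hom)"
proof (rule category_pair_category)
  fix S T :: "'a mobi_algebra \<times> ('a, 'b) pointed_mobi_space" and f g
  assume "(f, g) \<in> pointed_affine_mobi_hom S T"
  then show "f \<in> carrier (fst S) \<rightarrow>\<^sub>E carrier (fst T) \<and> g \<in> carrier (snd S) \<rightarrow>\<^sub>E carrier (snd T)"
    by (cases S; cases T) (auto simp: pointed_affine_mobi_hom_def mobi_algebra_hom_def PiE_def)
next
  fix S :: "'a mobi_algebra \<times> ('a, 'b) pointed_mobi_space"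
  assume ob: "S \<in> pointed_affine_mobi_objects"
  obtain A X where S: "S = (A, X)"
    by (cases S)
  then interpret affine_mobi_space A X
    using ob by (simp add: pointed_affine_mobi_objects_def)
  show "(\<lambda>a\<in>carrier (fst S). a, \<lambda>x\<in>carrier (snd S). x) \<in> pointed_affine_mobi_hom S S"
    using ob by (simp add: pointed_affine_mobi_hom_def mobi_algebra_hom_def S
        pointed_affine_mobi_objects_def sop_closed mop_closed mzero_closed mone_closed mhalf_closed)
next
  fix S T U :: "'a mobi_algebra \<times> ('a, 'b) pointed_mobi_space" and f g f' g'
  assume ob: "S \<in> pointed_affine_mobi_objects"
    and fg: "(f, g) \<in> pointed_affine_mobi_hom S T" and fg': "(f', g') \<in> pointed_affine_mobi_hom T U"
  obtain A X A1 X1 A2 X2 where S: "S = (A, X)" "T = (A1, X1)" "U = (A2, X2)"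
    by (metis surj_pair)
  then interpret affine_mobi_space A X
    using ob by (simp add: pointed_affine_mobi_objects_def)
  show "(compose (carrier (fst S)) f' f, compose (carrier (snd S)) g' g) \<in> pointed_affine_mobi_hom S U"
    using ob fg fg' by (simp add: pointed_affine_mobi_hom_def mobi_algebra_hom_def S compose_def
        Pi_iff PiE_iff
        pointed_affine_mobi_objects_def sop_closed mop_closed mzero_closed mone_closed mhalf_closed)
qed

section \<open>From modules to mobi spaces\<close>

text \<open>The value \<open>undefined\<close> off the carrier is the one that
  \<open>extensional3\<close> demands; it makes the round trips equalities of structures.\<close>

definition ring_to_mobi :: "('a, 'r) ring_scheme \<Rightarrow> 'a mobi_algebra" where
  "ring_to_mobi R = \<lparr>carrier = carrier R,
     mop = (\<lambda>a b c. if a \<in> carrier R \<and> b \<in> carrier R \<and> c \<in> carrier R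
       then (\<one>\<^bsub>R\<^esub> \<ominus>\<^bsub>R\<^esub> b) \<otimes>\<^bsub>R\<^esub> a \<oplus>\<^bsub>R\<^esub> b \<otimes>\<^bsub>R\<^esub> c else undefined),
     mzero = \<zero>\<^bsub>R\<^esub>, mhalf = inv\<^bsub>R\<^esub> (\<one>\<^bsub>R\<^esub> \<oplus>\<^bsub>R\<^esub> \<one>\<^bsub>R\<^esub>), mone = \<one>\<^bsub>R\<^esub>\<rparr>"

definition module_to_space ::
    "('a, 'r) ring_scheme \<Rightarrow> ('a, 'x, 's) rmodule_scheme \<Rightarrow> ('a, 'x) pointed_mobi_space" where
  "module_to_space R X = \<lparr>carrier = carrier X,
     sop = (\<lambda>x a y. if x \<in> carrier X \<and> a \<in> carrier R \<and> y \<in> carrier X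
       then act X (\<one>\<^bsub>R\<^esub> \<ominus>\<^bsub>R\<^esub> a) x \<otimes>\<^bsub>X\<^esub> act X a y else undefined),
     origin = \<one>\<^bsub>X\<^esub>\<rparr>"

text \<open>The inner restriction makes each left multiplication an extensional map, as membership
  in \<open>End_ring\<close> requires.\<close>

definition regular_module :: "('a, 'r) ring_scheme \<Rightarrow> ('a, 'a) rmodule" where
  "regular_module R = \<lparr>carrier = carrier R, monoid.mult = add R, one = \<zero>\<^bsub>R\<^esub>,
     act = (\<lambda>a\<in>carrier R. \<lambda>b\<in>carrier R. a \<otimes>\<^bsub>R\<^esub> b)\<rparr>"

text \<open>The two distributive laws make left multiplication additive in each argument, and
  associativity turns products into composites.\<close>

lemma (in ring) ring_module_regular: "ring_module R (regular_module R)"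
proof -
  interpret X: comm_group "regular_module R"
    by (rule comm_groupI) (auto simp: regular_module_def a_ac intro: add.l_inv_ex)
  show ?thesis
    by unfold_locales
      (auto simp: ring_hom_def End_ring_def regular_module_def hom_def compose_def fun_eq_iff
        r_distr l_distr m_assoc)
qed

lemma (in ring) minus_add_cancel: "\<lbrakk>a \<in> carrier R; b \<in> carrier R\<rbrakk> \<Longrightarrow> (a \<ominus> b) \<oplus> b = a"
  by (simp add: a_minus_def a_assoc l_neg)

text \<open>Used to compute complements: a summand that completes \<open>b\<close> to one is
  recognised as one minus \<open>b\<close>.\<close>

lemma (in ring) add_eq_imp_minus_eq:
  assumes "a \<oplus> b = c" "a \<in> carrier R" "b \<in> carrier R"
  shows "c \<ominus> b = a"
  using assms(2,3) unfolding assms(1)[symmetric] by (simp add: a_minus_def a_assoc r_neg)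

section \<open>The inverse of 2 in a unitary ring\<close>

context ring_with_half
begin

abbreviation two where "two \<equiv> \<one> \<oplus> \<one>"
abbreviation half where "half \<equiv> inv two"

lemma half_closed [simp]: "half \<in> carrier R"
  using two_invertible by simp

lemma half_two [simp]: "half \<otimes> two = \<one>" and two_half [simp]: "two \<otimes> half = \<one>"
  using two_invertible by simp_all

lemma half_add_half: "half \<oplus> half = \<one>"
  using two_half l_distr[of \<one> \<one> half] by simp

lemma one_minus_half [simp]: "\<one> \<ominus> half = half"
  by (rule add_eq_imp_minus_eq) (simp_all add: half_add_half)

lemma two_half_mult: "a \<in> carrier R \<Longrightarrow> two \<otimes> (half \<otimes> a) = a"
  by (simp add: m_assoc[symmetric])

lemma half_unique: "\<lbrakk>two \<otimes> a = \<one>; a \<otimes> two = \<one>; a \<in> carrier R\<rbrakk> \<Longrightarrow> a = half"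
  by (rule inv_unique') simp_all

text \<open>The element \<open>two\<close> is central because it is a sum of units; multiplying by
  \<open>half\<close> on both sides passes this on to its inverse.\<close>

lemma half_comm:
  assumes "a \<in> carrier R" shows "half \<otimes> a = a \<otimes> half"
proof -
  have "two \<otimes> a = a \<otimes> two"
    using assms by (simp add: l_distr r_distr)
  then have "half \<otimes> (two \<otimes> a) \<otimes> half = half \<otimes> (a \<otimes> two) \<otimes> half"
    by simp
  moreover have "half \<otimes> (two \<otimes> a) \<otimes> half = a \<otimes> half"
    using assms by (simp add: m_assoc[symmetric])
  moreover have "half \<otimes> (a \<otimes> two) \<otimes> half = half \<otimes> a"
    using assms by (simp add: m_assoc)
  ultimately show ?thesis by simp
qed

end

section \<open>Affine combinations in a module\<close>

locale half_module = ring_with_half R + ring_module R X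
  for R :: "('a, 'r) ring_scheme" (structure) and X :: "('a, 'x, 's) rmodule_scheme"
begin

lemma X_ac:
  assumes "x \<in> carrier X" "y \<in> carrier X" "z \<in> carrier X"
  shows "x \<otimes>\<^bsub>X\<^esub> y \<otimes>\<^bsub>X\<^esub> z = x \<otimes>\<^bsub>X\<^esub> (y \<otimes>\<^bsub>X\<^esub> z)"
    and "x \<otimes>\<^bsub>X\<^esub> y = y \<otimes>\<^bsub>X\<^esub> x"
    and "x \<otimes>\<^bsub>X\<^esub> (y \<otimes>\<^bsub>X\<^esub> z) = y \<otimes>\<^bsub>X\<^esub> (x \<otimes>\<^bsub>X\<^esub> z)"
proof -
  interpret comm_group X ..
  show "x \<otimes>\<^bsub>X\<^esub> y \<otimes>\<^bsub>X\<^esub> z = x \<otimes>\<^bsub>X\<^esub> (y \<otimes>\<^bsub>X\<^esub> z)"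
    and "x \<otimes>\<^bsub>X\<^esub> y = y \<otimes>\<^bsub>X\<^esub> x"
    and "x \<otimes>\<^bsub>X\<^esub> (y \<otimes>\<^bsub>X\<^esub> z) = y \<otimes>\<^bsub>X\<^esub> (x \<otimes>\<^bsub>X\<^esub> z)"
    using assms by (auto simp: m_ac)
qed

lemma act_distr: "\<lbrakk>a \<in> carrier R; x \<in> carrier X; y \<in> carrier X\<rbrakk>
    \<Longrightarrow> act X a (x \<otimes>\<^bsub>X\<^esub> y) = act X a x \<otimes>\<^bsub>X\<^esub> act X a y"
  using act_ring_hom by (auto simp: ring_hom_def End_ring_def hom_def Pi_iff)

lemma act_act: "\<lbrakk>a \<in> carrier R; b \<in> carrier R; x \<in> carrier X\<rbrakk>
    \<Longrightarrow> act X a (act X b x) = act X (a \<otimes> b) x"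
  using act_ring_hom by (auto simp: ring_hom_def End_ring_def compose_def)

lemma act_add: "\<lbrakk>a \<in> carrier R; b \<in> carrier R; x \<in> carrier X\<rbrakk>
    \<Longrightarrow> act X (a \<oplus> b) x = act X a x \<otimes>\<^bsub>X\<^esub> act X b x"
  using act_ring_hom by (auto simp: ring_hom_def End_ring_def)

lemma act_one [simp]: "x \<in> carrier X \<Longrightarrow> act X \<one> x = x"
  using act_ring_hom by (auto simp: ring_hom_def End_ring_def)

lemma act_zero [simp]: "x \<in> carrier X \<Longrightarrow> act X \<zero> x = \<one>\<^bsub>X\<^esub>"
  using act_add[of \<zero> \<zero> x] by simp

lemma act_unit [simp]: "a \<in> carrier R \<Longrightarrow> act X a \<one>\<^bsub>X\<^esub> = \<one>\<^bsub>X\<^esub>"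
  using act_distr[of a "\<one>\<^bsub>X\<^esub>" "\<one>\<^bsub>X\<^esub>"] by simp

text \<open>This is the operation of \<open>module_to_space\<close> without the case distinction on
  carriers.\<close>

definition comb :: "'x \<Rightarrow> 'a \<Rightarrow> 'x \<Rightarrow> 'x" where
  "comb x a y = act X (\<one> \<ominus> a) x \<otimes>\<^bsub>X\<^esub> act X a y"

lemma comb_closed [simp]:
  "\<lbrakk>x \<in> carrier X; a \<in> carrier R; y \<in> carrier X\<rbrakk> \<Longrightarrow> comb x a y \<in> carrier X"
  by (simp add: comb_def)

lemma act_comb:
  assumes "x \<in> carrier X" "a \<in> carrier R" "y \<in> carrier X" "c \<in> carrier R"
  shows "act X c (comb x a y) = act X (c \<otimes> (\<one> \<ominus> a)) x \<otimes>\<^bsub>X\<^esub> act X (c \<otimes> a) y"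
  using assms by (simp add: comb_def act_distr act_act)

lemma comb_zero: "\<lbrakk>x \<in> carrier X; y \<in> carrier X\<rbrakk> \<Longrightarrow> comb x \<zero> y = x"
  by (simp add: comb_def a_minus_def)

lemma comb_one: "\<lbrakk>x \<in> carrier X; y \<in> carrier X\<rbrakk> \<Longrightarrow> comb x \<one> y = y"
  by (simp add: comb_def a_minus_def r_neg)

lemma comb_same: "\<lbrakk>x \<in> carrier X; a \<in> carrier R\<rbrakk> \<Longrightarrow> comb x a x = x"
  using act_add[of "\<one> \<ominus> a" a x] by (simp add: comb_def minus_add_cancel)

lemma comb_half: "\<lbrakk>x \<in> carrier X; y \<in> carrier X\<rbrakk> \<Longrightarrow> comb x half y = act X half (x \<otimes>\<^bsub>X\<^esub> y)"
  by (simp add: comb_def act_distr)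

lemma act_two_half [simp]: "x \<in> carrier X \<Longrightarrow> act X two (act X half x) = x"
  by (simp add: act_act)

text \<open>Acting with \<open>two\<close> undoes the halving of the sum, and the group
  \<open>X\<close> is cancellative.\<close>

lemma comb_half_cancel:
  assumes "x \<in> carrier X" "y \<in> carrier X" "y' \<in> carrier X" "comb x half y = comb x half y'"
  shows "y = y'"
proof -
  have "act X two (act X half (x \<otimes>\<^bsub>X\<^esub> y)) = act X two (act X half (x \<otimes>\<^bsub>X\<^esub> y'))"
    using assms by (simp add: comb_half)
  then show ?thesis
    using assms by simp
qed

lemma comb_comb:
  assumes x: "x \<in> carrier X" "y \<in> carrier X" and a: "a \<in> carrier R" "b \<in> carrier R" "c \<in> carrier R"
  shows "comb (comb x a y) b (comb x c y) = comb x ((\<one> \<ominus> b) \<otimes> a \<oplus> b \<otimes> c) y"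
proof -
  \<comment> \<open>The left side expands to \<open>?s\<close> acting on \<open>x\<close> plus
    \<open>?p\<close> acting on \<open>y\<close>. The two coefficients sum to one, so
    \<open>?s\<close> is the complement of \<open>?p\<close>.\<close>
  let ?p = "(\<one> \<ominus> b) \<otimes> a \<oplus> b \<otimes> c" and ?s = "(\<one> \<ominus> b) \<otimes> (\<one> \<ominus> a) \<oplus> b \<otimes> (\<one> \<ominus> c)"
  have "?s \<oplus> ?p = (\<one> \<ominus> b) \<otimes> ((\<one> \<ominus> a) \<oplus> a) \<oplus> b \<otimes> ((\<one> \<ominus> c) \<oplus> c)"
    using a by (simp add: r_distr a_ac)
  also have "\<dots> = \<one>"
    using a by (simp add: minus_add_cancel)
  finally have s: "\<one> \<ominus> ?p = ?s"
    by (rule add_eq_imp_minus_eq) (use a in simp_all)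
  show ?thesis
    unfolding comb_def[of x ?p] s using x a
    by (simp add: comb_def[of "comb x a y"] act_comb act_add X_ac)
qed

text \<open>The two sides differ in the order in which \<open>half\<close> and the coefficients
  \<open>\<one> \<ominus> a\<close> and \<open>a\<close> act, so centrality of \<open>half\<close>
  settles the matter.\<close>

lemma comb_affine:
  assumes "x1 \<in> carrier X" "x2 \<in> carrier X" "y1 \<in> carrier X" "y2 \<in> carrier X" "a \<in> carrier R"
  shows "comb (comb x1 a y1) half (comb x2 a y2) = comb (comb x1 half x2) a (comb y1 half y2)"
  using assms by (simp add: comb_half)
    (simp add: comb_def act_distr act_act half_comm X_ac)

end

section \<open>The mobi algebra of a ring and the mobi space of a module\<close>

lemma (in ring_with_half) half_module_regular: "half_module R (regular_module R)"
  using ring_with_half_axioms ring_module_regular by (simp add: half_module_def)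

text \<open>Identifies the operation of \<open>ring_to_mobi\<close> with the affine combination in
  the regular module, so that its laws are inherited.\<close>

lemma (in ring_with_half) comb_regular:
  "\<lbrakk>a \<in> carrier R; b \<in> carrier R; c \<in> carrier R\<rbrakk>
    \<Longrightarrow> half_module.comb R (regular_module R) a b c = (\<one> \<ominus> b) \<otimes> a \<oplus> b \<otimes> c"
  by (simp add: half_module.comb_def[OF half_module_regular]) (simp add: regular_module_def)

lemma ring_to_mobi_simps [simp]:
  "carrier (ring_to_mobi R) = carrier R" "mzero (ring_to_mobi R) = \<zero>\<^bsub>R\<^esub>"
  "mone (ring_to_mobi R) = \<one>\<^bsub>R\<^esub>" "mhalf (ring_to_mobi R) = inv\<^bsub>R\<^esub> (\<one>\<^bsub>R\<^esub> \<oplus>\<^bsub>R\<^esub> \<one>\<^bsub>R\<^esub>)"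
  "\<lbrakk>a \<in> carrier R; b \<in> carrier R; c \<in> carrier R\<rbrakk> \<Longrightarrow> mop (ring_to_mobi R) a b c =
    (\<one>\<^bsub>R\<^esub> \<ominus>\<^bsub>R\<^esub> b) \<otimes>\<^bsub>R\<^esub> a \<oplus>\<^bsub>R\<^esub> b \<otimes>\<^bsub>R\<^esub> c"
  by (simp_all add: ring_to_mobi_def)

lemma module_to_space_simps [simp]:
  "carrier (module_to_space R X) = carrier X" "origin (module_to_space R X) = \<one>\<^bsub>X\<^esub>"
  "\<lbrakk>x \<in> carrier X; a \<in> carrier R; y \<in> carrier X\<rbrakk> \<Longrightarrow> sop (module_to_space R X) x a y =
    act X (\<one>\<^bsub>R\<^esub> \<ominus>\<^bsub>R\<^esub> a) x \<otimes>\<^bsub>X\<^esub> act X a y"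
  by (simp_all add: module_to_space_def)

text \<open>(A3)--(A8) are laws of \<open>comb\<close> in the regular module. (A1), (A2) and the
  existence of 2 are computed in the ring.\<close>

lemma (in ring_with_half) mobi_algebra_with_two_ring_to_mobi: "mobi_algebra_with_two (ring_to_mobi R)"
proof -
  interpret reg: half_module R "regular_module R"
    by (rule half_module_regular)
  have carrier: "carrier (regular_module R) = carrier R"
    by (simp add: regular_module_def)
  have mop: "mop (ring_to_mobi R) a b c = reg.comb a b c"
    if "a \<in> carrier R" "b \<in> carrier R" "c \<in> carrier R" for a b c
    using that by (simp add: comb_regular)
  \<comment> \<open>In (A7) the parameter is itself a value of the operation, so the ring expression
    supplied by \<open>comb_comb\<close> is folded back into \<open>comb\<close>.\<close>
  have comb_comb: "reg.comb (reg.comb a b\<^sub>1 c) b\<^sub>2 (reg.comb a b\<^sub>3 c) = reg.comb a (reg.comb b\<^sub>1 b\<^sub>2 b\<^sub>3) c"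
    if "a \<in> carrier R" "b\<^sub>1 \<in> carrier R" "b\<^sub>2 \<in> carrier R" "b\<^sub>3 \<in> carrier R" "c \<in> carrier R"
    for a b\<^sub>1 b\<^sub>2 b\<^sub>3 c
    using that reg.comb_comb[of a c b\<^sub>1 b\<^sub>2 b\<^sub>3] by (simp add: carrier comb_regular)
  note comb = reg.comb_closed[unfolded carrier] reg.comb_zero[unfolded carrier]
    reg.comb_one[unfolded carrier] reg.comb_same[unfolded carrier]
    reg.comb_affine[unfolded carrier] comb_comb
  \<comment> \<open>With the expansion into ring terms switched off, \<open>mop\<close> is rewritten
    to \<open>reg.comb\<close>, to which the inherited laws apply.\<close>
  note [simp del] = ring_to_mobi_simps(5)
  show ?thesis
  proof
    show "mop (ring_to_mobi R) (mone (ring_to_mobi R)) (mhalf (ring_to_mobi R)) (mzero (ring_to_mobi R))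
        = mhalf (ring_to_mobi R)"
      by (simp add: ring_to_mobi_simps(5))
    show "\<exists>t\<in>carrier (ring_to_mobi R).
        mop (ring_to_mobi R) (mzero (ring_to_mobi R)) (mhalf (ring_to_mobi R)) t = mone (ring_to_mobi R)"
      by (rule bexI[of _ two]) (simp_all add: ring_to_mobi_simps(5))
    fix a assume "a \<in> carrier (ring_to_mobi R)"
    then show "mop (ring_to_mobi R) (mzero (ring_to_mobi R)) a (mone (ring_to_mobi R)) = a"
      by (simp add: ring_to_mobi_simps(5))
  next
    fix a b c
    assume "a \<in> carrier (ring_to_mobi R)" "b \<in> carrier (ring_to_mobi R)" "c \<in> carrier (ring_to_mobi R)"
      "mop (ring_to_mobi R) a (mhalf (ring_to_mobi R)) b = mop (ring_to_mobi R) a (mhalf (ring_to_mobi R)) c"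
    then show "b = c"
      using reg.comb_half_cancel[of a b c] by (simp add: mop carrier)
  qed (simp_all add: mop comb)
qed

lemma (in half_module) affine_mobi_space_module_to_space:
  "affine_mobi_space (ring_to_mobi R) (module_to_space R X)"
proof -
  interpret A: mobi_algebra_with_two "ring_to_mobi R"
    by (rule mobi_algebra_with_two_ring_to_mobi)
  have sop: "sop (module_to_space R X) x a y = comb x a y"
    if "x \<in> carrier X" "a \<in> carrier R" "y \<in> carrier X" for x a y
    using that by (simp add: comb_def)
  \<comment> \<open>Now \<open>sop\<close> becomes \<open>comb\<close>, while \<open>mop\<close>
    still expands to the ring term in which \<open>comb_comb\<close> expresses (X5).\<close>
  note [simp del] = module_to_space_simps(3)
  show ?thesis
  proof unfold_locales
    fix x y y'
    assume "x \<in> carrier (module_to_space R X)" "y \<in> carrier (module_to_space R X)"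
      "y' \<in> carrier (module_to_space R X)"
      "sop (module_to_space R X) x (mhalf (ring_to_mobi R)) y
        = sop (module_to_space R X) x (mhalf (ring_to_mobi R)) y'"
    then show "y = y'"
      using comb_half_cancel[of x y y'] by (simp add: sop)
  qed (simp_all add: sop comb_zero comb_one comb_same comb_affine comb_comb)
qed

section \<open>From pointed affine mobi spaces to modules\<close>

text \<open>Existence comes from \<open>ex_two\<close>, uniqueness from (A6): 2 is a property of the
  algebra and not one of its constants.\<close>

definition mobi_two :: "('a, 'r) mobi_algebra_scheme \<Rightarrow> 'a" where
  "mobi_two A = (THE t. t \<in> carrier A \<and> mop A (mzero A) (mhalf A) t = mone A)"

definition mobi_to_ring :: "('a, 'r) mobi_algebra_scheme \<Rightarrow> 'a ring" where
  "mobi_to_ring A = \<lparr>carrier = carrier A,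
     monoid.mult = (\<lambda>a b. if a \<in> carrier A \<and> b \<in> carrier A
       then mop A (mzero A) a b else undefined),
     one = mone A, zero = mzero A,
     add = (\<lambda>a b. if a \<in> carrier A \<and> b \<in> carrier A
       then mop A (mzero A) (mobi_two A) (mop A a (mhalf A) b) else undefined)\<rparr>"

definition space_to_module ::
    "('a, 'r) mobi_algebra_scheme \<Rightarrow> ('a, 'x, 's) pointed_mobi_space_scheme \<Rightarrow> ('a, 'x) rmodule" where
  "space_to_module A X = \<lparr>carrier = carrier X,
     monoid.mult = (\<lambda>x y. if x \<in> carrier X \<and> y \<in> carrier X
       then sop X (origin X) (mobi_two A) (sop X x (mhalf A) y) else undefined),
     one = origin X,
     act = (\<lambda>a\<in>carrier A. \<lambda>x\<in>carrier X. sop X (origin X) a x)\<rparr>"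

definition regular_space :: "('a, 'r) mobi_algebra_scheme \<Rightarrow> ('a, 'a) pointed_mobi_space" where
  "regular_space A = \<lparr>carrier = carrier A, sop = mop A, origin = mzero A\<rparr>"

lemma regular_space_simps [simp]:
  "carrier (regular_space A) = carrier A" "sop (regular_space A) = mop A"
  "origin (regular_space A) = mzero A"
  by (simp_all add: regular_space_def)

lemma mobi_to_ring_simps [simp]:
  "carrier (mobi_to_ring A) = carrier A"
  "\<one>\<^bsub>mobi_to_ring A\<^esub> = mone A" "\<zero>\<^bsub>mobi_to_ring A\<^esub> = mzero A"
  "\<lbrakk>a \<in> carrier A; b \<in> carrier A\<rbrakk> \<Longrightarrow> a \<otimes>\<^bsub>mobi_to_ring A\<^esub> b = mop A (mzero A) a b"
  "\<lbrakk>a \<in> carrier A; b \<in> carrier A\<rbrakk> \<Longrightarrow>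
    a \<oplus>\<^bsub>mobi_to_ring A\<^esub> b = mop A (mzero A) (mobi_two A) (mop A a (mhalf A) b)"
  by (simp_all add: mobi_to_ring_def)

lemma space_to_module_simps [simp]:
  "carrier (space_to_module A X) = carrier X" "\<one>\<^bsub>space_to_module A X\<^esub> = origin X"
  "\<lbrakk>x \<in> carrier X; y \<in> carrier X\<rbrakk> \<Longrightarrow>
    x \<otimes>\<^bsub>space_to_module A X\<^esub> y = sop X (origin X) (mobi_two A) (sop X x (mhalf A) y)"
  "\<lbrakk>a \<in> carrier A; x \<in> carrier X\<rbrakk> \<Longrightarrow> act (space_to_module A X) a x = sop X (origin X) a x"
  by (simp_all add: space_to_module_def)

section \<open>The element 2 of a mobi algebra\<close>

context mobi_algebra_with_two
begin

lemma mobi_two_unique: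
  assumes "t \<in> carrier A" "mop A (mzero A) (mhalf A) t = mone A"
  shows "mobi_two A = t"
  unfolding mobi_two_def
  by (rule the_equality) (use assms A6[of "mzero A" _ t] mzero_closed in \<open>blast, metis\<close>)

lemma mobi_two_closed: "mobi_two A \<in> carrier A"
  and half_mobi_two: "mop A (mzero A) (mhalf A) (mobi_two A) = mone A"
proof -
  obtain t where "t \<in> carrier A" "mop A (mzero A) (mhalf A) t = mone A"
    using ex_two by blast
  moreover from this have "mobi_two A = t"
    by (rule mobi_two_unique)
  ultimately show "mobi_two A \<in> carrier A" "mop A (mzero A) (mhalf A) (mobi_two A) = mone A"
    by simp_all
qed

lemmas closed = mop_closed mzero_closed mhalf_closed mone_closed mobi_two_closed

text \<open>The defining equation gives the product of 1/2 and 2 in one order. For the other,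
  multiply by 1/2 on the left, which is injective by (A6), and reassociate.\<close>

lemma mobi_two_half: "mop A (mzero A) (mobi_two A) (mhalf A) = mone A"
proof (rule A6[of "mzero A"])
  \<comment> \<open>Writing the first \<open>mzero A\<close> as a combination with parameter zero
    lets (A7), read backwards, serve as associativity of the product.\<close>
  have "mop A (mzero A) (mhalf A) (mop A (mzero A) (mobi_two A) (mhalf A))
      = mop A (mop A (mzero A) (mzero A) (mhalf A)) (mhalf A) (mop A (mzero A) (mobi_two A) (mhalf A))"
    by (simp only: A4 closed)
  also have "\<dots> = mop A (mzero A) (mop A (mzero A) (mhalf A) (mobi_two A)) (mhalf A)"
    by (rule A7[symmetric]) (simp_all only: closed)
  also have "\<dots> = mop A (mzero A) (mhalf A) (mone A)"
    by (simp only: half_mobi_two A2 A5 closed)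
  finally show "mop A (mzero A) (mhalf A) (mop A (mzero A) (mobi_two A) (mhalf A))
      = mop A (mzero A) (mhalf A) (mone A)" .
qed (simp_all only: closed)

end

section \<open>Scalars, midpoints and sums in a pointed affine mobi space\<close>

locale pointed_affine_mobi_space = mobi_algebra_with_two A + affine_mobi_space A X
  for A :: "('a, 'r) mobi_algebra_scheme" and X :: "('a, 'x, 's) pointed_mobi_space_scheme" +
  assumes origin_closed: "origin X \<in> carrier X"
begin

definition scal :: "'a \<Rightarrow> 'x \<Rightarrow> 'x" where
  "scal a x = sop X (origin X) a x"

definition mid :: "'x \<Rightarrow> 'x \<Rightarrow> 'x" where
  "mid x y = sop X x (mhalf A) y"

definition plus :: "'x \<Rightarrow> 'x \<Rightarrow> 'x" where
  "plus x y = scal (mobi_two A) (mid x y)"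

lemma scal_closed: "\<lbrakk>a \<in> carrier A; x \<in> carrier X\<rbrakk> \<Longrightarrow> scal a x \<in> carrier X"
  and mid_closed: "\<lbrakk>x \<in> carrier X; y \<in> carrier X\<rbrakk> \<Longrightarrow> mid x y \<in> carrier X"
  by (simp_all add: scal_def mid_def sop_closed origin_closed closed)

lemma plus_closed: "\<lbrakk>x \<in> carrier X; y \<in> carrier X\<rbrakk> \<Longrightarrow> plus x y \<in> carrier X"
  by (simp add: plus_def scal_closed mid_closed closed)

lemmas closed_space = closed scal_closed mid_closed plus_closed sop_closed origin_closed

lemma scal_origin: "a \<in> carrier A \<Longrightarrow> scal a (origin X) = origin X"
  by (simp add: scal_def X3 origin_closed)

lemma scal_one: "x \<in> carrier X \<Longrightarrow> scal (mone A) x = x"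
  by (simp add: scal_def X2 origin_closed)

lemma scal_zero: "x \<in> carrier X \<Longrightarrow> scal (mzero A) x = origin X"
  by (simp add: scal_def X1 origin_closed)

text \<open>This is (X5) on the line from the origin to \<open>x\<close>: sending scalars to points
  carries \<open>mop\<close> to \<open>sop\<close>. Associativity and additivity in the scalar both
  come from it.\<close>

lemma sop_scal:
  "\<lbrakk>a \<in> carrier A; b \<in> carrier A; c \<in> carrier A; x \<in> carrier X\<rbrakk>
    \<Longrightarrow> sop X (scal a x) b (scal c x) = scal (mop A a b c) x"
  by (simp add: scal_def X5 origin_closed)

lemma scal_scal:
  assumes "a \<in> carrier A" "b \<in> carrier A" "x \<in> carrier X"
  shows "scal a (scal b x) = scal (mop A (mzero A) a b) x"
  using sop_scal[of "mzero A" a b x] assms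
  by (simp add: scal_zero closed) (simp add: scal_def)

lemma scal_half: "scal (mhalf A) x = mid (origin X) x"
  by (simp add: scal_def mid_def)

lemma half_two_scal [simp]: "x \<in> carrier X \<Longrightarrow> scal (mhalf A) (scal (mobi_two A) x) = x"
  and two_half_scal [simp]: "x \<in> carrier X \<Longrightarrow> scal (mobi_two A) (scal (mhalf A) x) = x"
  by (simp_all add: scal_scal closed half_mobi_two mobi_two_half scal_one)

text \<open>Together with \<open>half_plus\<close> this reduces equations between sums to equations
  between midpoints.\<close>

lemma half_scal_cancel:
  "\<lbrakk>scal (mhalf A) x = scal (mhalf A) y; x \<in> carrier X; y \<in> carrier X\<rbrakk> \<Longrightarrow> x = y"
  by (metis two_half_scal)

lemma half_plus: "\<lbrakk>x \<in> carrier X; y \<in> carrier X\<rbrakk> \<Longrightarrow> scal (mhalf A) (plus x y) = mid x y"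
  by (simp add: plus_def mid_closed)

text \<open>The endpoints are the values of \<open>sop\<close> at parameters one and zero; (X5)
  combines them, and (A1) says that the reversed midpoint is again at 1/2.\<close>

lemma mid_comm:
  assumes "x \<in> carrier X" "y \<in> carrier X"
  shows "mid x y = mid y x"
  using X5[of x y "mone A" "mhalf A" "mzero A"] assms
  by (simp add: mid_def closed X1 X2 A1)

lemma mid_sop:
  "\<lbrakk>x1 \<in> carrier X; x2 \<in> carrier X; y1 \<in> carrier X; y2 \<in> carrier X; a \<in> carrier A\<rbrakk>
    \<Longrightarrow> mid (sop X x1 a y1) (sop X x2 a y2) = sop X (mid x1 x2) a (mid y1 y2)"
  by (simp add: mid_def affine)

lemma scal_mid:
  assumes "a \<in> carrier A" "x \<in> carrier X" "y \<in> carrier X"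
  shows "scal a (mid x y) = mid (scal a x) (scal a y)"
proof -
  have "mid (origin X) (origin X) = origin X"
    by (simp add: mid_def X3 closed origin_closed)
  then show ?thesis
    using assms mid_sop[of "origin X" "origin X" x y a] by (simp add: scal_def origin_closed)
qed

text \<open>Affineness at the parameter \<open>mhalf A\<close>.\<close>

lemma mid_medial:
  "\<lbrakk>x \<in> carrier X; y \<in> carrier X; z \<in> carrier X; w \<in> carrier X\<rbrakk>
    \<Longrightarrow> mid (mid x y) (mid z w) = mid (mid x z) (mid y w)"
  unfolding mid_def by (rule affine) (simp_all add: closed)

text \<open>Halving is the midpoint with the origin, which every scalar fixes; hence by
  \<open>scal_mid\<close> it commutes with \<open>scal a\<close>, and after halving the sums are
  midpoints.\<close>

lemma scal_plus:
  assumes "a \<in> carrier A" "x \<in> carrier X" "y \<in> carrier X"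
  shows "scal a (plus x y) = plus (scal a x) (scal a y)"
proof (rule half_scal_cancel)
  have "scal (mhalf A) (scal a (plus x y)) = mid (scal a (origin X)) (scal a (plus x y))"
    using assms by (simp add: scal_half scal_origin)
  also have "\<dots> = scal a (scal (mhalf A) (plus x y))"
    using assms by (simp add: scal_half scal_mid closed_space)
  also have "\<dots> = scal (mhalf A) (plus (scal a x) (scal a y))"
    using assms by (simp add: half_plus scal_mid closed_space)
  finally show "scal (mhalf A) (scal a (plus x y)) = scal (mhalf A) (plus (scal a x) (scal a y))" .
qed (use assms in \<open>simp_all add: closed_space\<close>)

lemma plus_comm: "\<lbrakk>x \<in> carrier X; y \<in> carrier X\<rbrakk> \<Longrightarrow> plus x y = plus y x"
  using mid_comm[of x y] by (simp add: plus_def)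

lemma plus_origin: "x \<in> carrier X \<Longrightarrow> plus (origin X) x = x"
  by (simp add: plus_def scal_half[symmetric])

text \<open>Halved twice, both sides are iterated midpoints of the four points origin,
  \<open>x\<close>, \<open>y\<close>, \<open>z\<close>, and the medial law exchanges the inner
  two.\<close>

lemma plus_assoc:
  assumes "x \<in> carrier X" "y \<in> carrier X" "z \<in> carrier X"
  shows "plus (plus x y) z = plus x (plus y z)"
proof (rule half_scal_cancel, rule half_scal_cancel)
  have "scal (mhalf A) (scal (mhalf A) (plus (plus x y) z))
      = mid (scal (mhalf A) (plus x y)) (scal (mhalf A) z)"
    using assms by (simp only: half_plus scal_mid closed_space)
  also have "\<dots> = mid (mid x y) (mid (origin X) z)"
    using assms by (simp only: half_plus) (simp add: scal_half)
  also have "\<dots> = mid (mid (origin X) x) (mid y z)"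
    using assms mid_medial[of x y "origin X" z] mid_comm[of x "origin X"] by (simp add: origin_closed)
  also have "\<dots> = mid (scal (mhalf A) x) (scal (mhalf A) (plus y z))"
    using assms by (simp only: half_plus) (simp add: scal_half)
  also have "\<dots> = scal (mhalf A) (scal (mhalf A) (plus x (plus y z)))"
    using assms by (simp only: half_plus scal_mid closed_space)
  finally show "scal (mhalf A) (scal (mhalf A) (plus (plus x y) z))
      = scal (mhalf A) (scal (mhalf A) (plus x (plus y z)))" .
qed (use assms in \<open>simp_all add: closed_space\<close>)

text \<open>The witness is the reflection of \<open>x\<close> in the origin, at parameter 2 on the
  line from \<open>x\<close>. By (X5) its midpoint with \<open>x\<close> lies at parameter 1, the
  origin itself.\<close>

lemma plus_inverse:
  assumes "x \<in> carrier X"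
  shows "plus (sop X x (mobi_two A) (origin X)) x = origin X"
proof -
  have "mid x (sop X x (mobi_two A) (origin X)) = origin X"
    using X5[of x "origin X" "mzero A" "mhalf A" "mobi_two A"] assms
    by (simp add: mid_def X1 X2 half_mobi_two closed_space)
  then show ?thesis
    using assms mid_comm[of x "sop X x (mobi_two A) (origin X)"]
    by (simp add: plus_def scal_origin closed_space)
qed

text \<open>The scalar on the left is the sum of \<open>a\<close> and \<open>b\<close> in
  \<open>mobi_to_ring A\<close>; the midpoint is taken along one line by \<open>sop_scal\<close>,
  then doubled.\<close>

lemma scal_add:
  assumes "a \<in> carrier A" "b \<in> carrier A" "x \<in> carrier X"
  shows "scal (mop A (mzero A) (mobi_two A) (mop A a (mhalf A) b)) x = plus (scal a x) (scal b x)"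
  using assms by (simp add: plus_def mid_def sop_scal scal_scal[symmetric] closed)

text \<open>The term \<open>mop A (mone A) a (mzero A)\<close> plays the role of 1 - a. With
  \<open>a\<close> written as in (A2), (A8) turns its midpoint with \<open>a\<close> into a
  combination of 1/2 with itself, and doubling gives one.\<close>

lemma complement_add:
  assumes "a \<in> carrier A"
  shows "mop A (mzero A) (mobi_two A) (mop A (mop A (mone A) a (mzero A)) (mhalf A) a) = mone A"
proof -
  have "mop A (mop A (mone A) a (mzero A)) (mhalf A) (mop A (mzero A) a (mone A))
      = mop A (mop A (mone A) (mhalf A) (mzero A)) a (mop A (mzero A) (mhalf A) (mone A))"
    using assms by (simp add: A8 closed)
  then have "mop A (mop A (mone A) a (mzero A)) (mhalf A) a = mhalf A"
    using assms by (simp add: A1 A2 A3 closed)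
  then show ?thesis
    by (simp add: mobi_two_half)
qed

text \<open>This recovers \<open>sop\<close> from the module operations, in the form of the formula
  in \<open>module_to_space\<close>.\<close>

lemma sop_eq_plus:
  assumes "x \<in> carrier X" "a \<in> carrier A" "y \<in> carrier X"
  shows "sop X x a y = plus (scal (mop A (mone A) a (mzero A)) x) (scal a y)"
proof (rule half_scal_cancel)
  have "scal (mop A (mone A) a (mzero A)) x = sop X x a (origin X)"
    using assms sop_scal[of "mone A" a "mzero A" x] by (simp add: scal_one scal_zero closed_space)
  then have "scal (mhalf A) (plus (scal (mop A (mone A) a (mzero A)) x) (scal a y))
      = mid (sop X x a (origin X)) (sop X (origin X) a y)"
    using assms by (simp add: half_plus closed_space) (simp add: scal_def)
  \<comment> \<open>Affineness is applied twice: both pairs of points have first entries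
    \<open>x\<close> and the origin and last entries the origin and \<open>y\<close>, up to
    order.\<close>
  also have "\<dots> = sop X (mid (origin X) x) a (mid (origin X) y)"
    using assms mid_comm[of x "origin X"] by (simp add: mid_sop closed_space)
  also have "\<dots> = mid (sop X (origin X) a (origin X)) (sop X x a y)"
    using assms by (simp add: mid_sop closed_space)
  also have "\<dots> = scal (mhalf A) (sop X x a y)"
    using assms by (simp add: X3 scal_half closed_space)
  finally show "scal (mhalf A) (sop X x a y)
      = scal (mhalf A) (plus (scal (mop A (mone A) a (mzero A)) x) (scal a y))" ..
qed (use assms in \<open>simp_all add: closed_space\<close>)

end

section \<open>The ring of a mobi algebra\<close>

lemma (in mobi_algebra_with_two) pointed_affine_mobi_space_regular:
  "pointed_affine_mobi_space A (regular_space A)"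
  by unfold_locales
    (auto simp: closed A3 A4 A5 A7 A8 intro: A6)

context mobi_algebra_with_two
begin

text \<open>Sum and product are \<open>plus\<close> and \<open>scal\<close> of the regular space.
  The two distributive laws are \<open>scal_plus\<close> and \<open>scal_add\<close>, associativity
  of the product is \<open>scal_scal\<close>, and the right unit law is (A2).\<close>

lemma ring_mobi_to_ring: "ring (mobi_to_ring A)"
proof -
  interpret reg: pointed_affine_mobi_space A "regular_space A"
    by (rule pointed_affine_mobi_space_regular)
  let ?R = "mobi_to_ring A"
  have add: "a \<oplus>\<^bsub>?R\<^esub> b = reg.plus a b" if "a \<in> carrier A" "b \<in> carrier A" for a b
    using that by (simp add: reg.plus_def reg.scal_def reg.mid_def)
  have mult: "a \<otimes>\<^bsub>?R\<^esub> b = reg.scal a b" if "a \<in> carrier A" "b \<in> carrier A" for a b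
    using that by (simp add: reg.scal_def)
  note space = regular_space_simps
  note cl = reg.plus_closed[unfolded space] reg.scal_closed[unfolded space] closed
  note [simp del] = mobi_to_ring_simps(4,5)
  show ?thesis
  proof (rule ringI)
    show "abelian_group ?R"
    proof (rule abelian_groupI)
      fix x assume x: "x \<in> carrier ?R"
      have "mop A x (mobi_two A) (mzero A) \<in> carrier ?R"
        using x by (simp add: closed)
      moreover have "mop A x (mobi_two A) (mzero A) \<oplus>\<^bsub>?R\<^esub> x = \<zero>\<^bsub>?R\<^esub>"
        using x reg.plus_inverse[of x] by (simp add: add closed)
      ultimately show "\<exists>y\<in>carrier ?R. y \<oplus>\<^bsub>?R\<^esub> x = \<zero>\<^bsub>?R\<^esub>"
        by blast
    next
      fix x y assume "x \<in> carrier ?R" "y \<in> carrier ?R"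
      then show "x \<oplus>\<^bsub>?R\<^esub> y = y \<oplus>\<^bsub>?R\<^esub> x"
        using reg.plus_comm[of x y] by (simp add: add)
    qed (simp_all add: add cl reg.plus_assoc reg.plus_origin[unfolded space])
    show "Group.monoid ?R"
    proof (rule monoidI)
      fix x y z assume "x \<in> carrier ?R" "y \<in> carrier ?R" "z \<in> carrier ?R"
      then show "x \<otimes>\<^bsub>?R\<^esub> y \<otimes>\<^bsub>?R\<^esub> z = x \<otimes>\<^bsub>?R\<^esub> (y \<otimes>\<^bsub>?R\<^esub> z)"
        using reg.scal_scal[of x y z] by (simp add: mult cl) (simp add: reg.scal_def)
    qed (simp_all add: mult cl reg.scal_one[unfolded space], simp add: reg.scal_def A2)
    fix x y z assume xyz: "x \<in> carrier ?R" "y \<in> carrier ?R" "z \<in> carrier ?R"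
    show "z \<otimes>\<^bsub>?R\<^esub> (x \<oplus>\<^bsub>?R\<^esub> y) = z \<otimes>\<^bsub>?R\<^esub> x \<oplus>\<^bsub>?R\<^esub> z \<otimes>\<^bsub>?R\<^esub> y"
      using xyz by (simp add: mult add cl reg.scal_plus)
    have "reg.scal (reg.plus x y) z = reg.plus (reg.scal x z) (reg.scal y z)"
      using xyz reg.scal_add[of x y z] by (simp add: add[symmetric]) (simp add: mobi_to_ring_simps)
    then show "(x \<oplus>\<^bsub>?R\<^esub> y) \<otimes>\<^bsub>?R\<^esub> z = x \<otimes>\<^bsub>?R\<^esub> z \<oplus>\<^bsub>?R\<^esub> y \<otimes>\<^bsub>?R\<^esub> z"
      using xyz by (simp add: mult add cl)
  qed
qed

text \<open>By (A3) the midpoint of one with itself is one, and (A2) is the right unit law for its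
  product with 2.\<close>

lemma one_add_one: "\<one>\<^bsub>mobi_to_ring A\<^esub> \<oplus>\<^bsub>mobi_to_ring A\<^esub> \<one>\<^bsub>mobi_to_ring A\<^esub> = mobi_two A"
  by (simp add: closed A2 A3)

lemma ring_with_half_mobi_to_ring: "ring_with_half (mobi_to_ring A)"
proof -
  interpret ring "mobi_to_ring A"
    by (rule ring_mobi_to_ring)
  have "mobi_two A \<in> Units (mobi_to_ring A)"
    by (auto simp: Units_def closed half_mobi_two mobi_two_half intro!: bexI[of _ "mhalf A"])
  then show ?thesis
    by unfold_locales (simp only: one_add_one)
qed

lemma inv_two: "inv\<^bsub>mobi_to_ring A\<^esub> (mobi_two A) = mhalf A"
proof -
  interpret ring "mobi_to_ring A"
    by (rule ring_mobi_to_ring)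
  show ?thesis
    by (rule inv_unique'[symmetric]) (simp_all add: closed half_mobi_two mobi_two_half)
qed

lemma one_minus:
  assumes "a \<in> carrier A"
  shows "\<one>\<^bsub>mobi_to_ring A\<^esub> \<ominus>\<^bsub>mobi_to_ring A\<^esub> a = mop A (mone A) a (mzero A)"
proof -
  interpret ring "mobi_to_ring A"
    by (rule ring_mobi_to_ring)
  interpret reg: pointed_affine_mobi_space A "regular_space A"
    by (rule pointed_affine_mobi_space_regular)
  have "mop A (mone A) a (mzero A) \<oplus>\<^bsub>mobi_to_ring A\<^esub> a = \<one>\<^bsub>mobi_to_ring A\<^esub>"
    using assms reg.complement_add by (simp add: closed)
  then show ?thesis
    by (rule add_eq_imp_minus_eq) (use assms in \<open>simp_all add: closed\<close>)
qed

end

section \<open>The module of a pointed affine mobi space\<close>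

context pointed_affine_mobi_space
begin

lemma space_to_module_plus:
  "\<lbrakk>x \<in> carrier X; y \<in> carrier X\<rbrakk> \<Longrightarrow> x \<otimes>\<^bsub>space_to_module A X\<^esub> y = plus x y"
  by (simp add: plus_def scal_def mid_def)

lemma space_to_module_act:
  "\<lbrakk>a \<in> carrier A; x \<in> carrier X\<rbrakk> \<Longrightarrow> act (space_to_module A X) a x = scal a x"
  by (simp add: scal_def)

lemma ring_module_space_to_module: "ring_module (mobi_to_ring A) (space_to_module A X)"
proof -
  interpret R: ring "mobi_to_ring A"
    by (rule ring_mobi_to_ring)
  note [simp del] = space_to_module_simps(3,4)
  note [simp] = space_to_module_plus space_to_module_act
  interpret M: comm_group "space_to_module A X"
  proof (rule comm_groupI)
    fix x assume x: "x \<in> carrier (space_to_module A X)"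
    then show "\<exists>y\<in>carrier (space_to_module A X). y \<otimes>\<^bsub>space_to_module A X\<^esub> x = \<one>\<^bsub>space_to_module A X\<^esub>"
      by (intro bexI[of _ "sop X x (mobi_two A) (origin X)"]) (simp_all add: plus_inverse closed_space)
  qed (simp_all add: closed_space plus_assoc plus_origin, simp add: plus_comm)
  \<comment> \<open>Elements of \<open>End_ring\<close> are extensional, so the ring homomorphism
    equations need checking only at points of the carrier.\<close>
  have ext: "act (space_to_module A X) a \<in> extensional (carrier X)" if "a \<in> carrier A" for a
    using that by (simp add: space_to_module_def)
  show ?thesis
  proof unfold_locales
    show "act (space_to_module A X) \<in> ring_hom (mobi_to_ring A) (End_ring (space_to_module A X))"
    proof (rule ring_hom_memI)
      fix a assume "a \<in> carrier (mobi_to_ring A)"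
      then show "act (space_to_module A X) a \<in> carrier (End_ring (space_to_module A X))"
        by (simp add: End_ring_def hom_def ext scal_plus closed_space)
    next
      fix a b assume "a \<in> carrier (mobi_to_ring A)" "b \<in> carrier (mobi_to_ring A)"
      then show "act (space_to_module A X) (a \<otimes>\<^bsub>mobi_to_ring A\<^esub> b) =
          act (space_to_module A X) a \<otimes>\<^bsub>End_ring (space_to_module A X)\<^esub> act (space_to_module A X) b"
        and "act (space_to_module A X) (a \<oplus>\<^bsub>mobi_to_ring A\<^esub> b) =
          act (space_to_module A X) a \<oplus>\<^bsub>End_ring (space_to_module A X)\<^esub> act (space_to_module A X) b"
        by (auto simp: End_ring_def closed_space scal_scal scal_add
            intro!: extensionalityI[of _ "carrier X"] ext)
          (auto simp: compose_def closed_space scal_scal)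
    next
      show "act (space_to_module A X) \<one>\<^bsub>mobi_to_ring A\<^esub> = \<one>\<^bsub>End_ring (space_to_module A X)\<^esub>"
        by (auto simp: End_ring_def closed_space scal_one
            intro!: extensionalityI[of _ "carrier X"] ext)
    qed
  qed
qed

end

section \<open>The isomorphism\<close>

definition to_mobi :: "'a ring \<times> ('a, 'x) rmodule \<Rightarrow> 'a mobi_algebra \<times> ('a, 'x) pointed_mobi_space" where
  "to_mobi = (\<lambda>(R, X). (ring_to_mobi R, module_to_space R X))"

definition to_module :: "'a mobi_algebra \<times> ('a, 'x) pointed_mobi_space \<Rightarrow> 'a ring \<times> ('a, 'x) rmodule" where
  "to_module = (\<lambda>(A, X). (mobi_to_ring A, space_to_module A X))"

section \<open>The bijection on objects\<close>

lemma module_objects_imp_half_module: "(R, X) \<in> module_objects \<Longrightarrow> half_module R X"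
  by (simp add: module_objects_def half_module_def)

lemma pointed_affine_mobi_objects_imp_space:
  "(A, X) \<in> pointed_affine_mobi_objects \<Longrightarrow> pointed_affine_mobi_space A X"
  by (simp add: pointed_affine_mobi_objects_def pointed_affine_mobi_space_def
      pointed_affine_mobi_space_axioms_def)

lemma to_mobi_object:
  assumes "S \<in> module_objects"
  shows "to_mobi S \<in> pointed_affine_mobi_objects"
proof -
  obtain R X where S: "S = (R, X)"
    by (cases S)
  then interpret half_module R X
    using assms by (simp add: module_objects_imp_half_module)
  have "\<one>\<^bsub>X\<^esub> \<in> carrier X"
    by simp
  then show ?thesis
    using mobi_algebra_with_two_ring_to_mobi affine_mobi_space_module_to_space
    by (auto simp: S to_mobi_def pointed_affine_mobi_objects_def extensional3_def
        ring_to_mobi_def module_to_space_def)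
qed

lemma to_module_object:
  assumes "S \<in> pointed_affine_mobi_objects"
  shows "to_module S \<in> module_objects"
proof -
  obtain A X where S: "S = (A, X)"
    by (cases S)
  then interpret pointed_affine_mobi_space A X
    using assms by (simp add: pointed_affine_mobi_objects_imp_space)
  show ?thesis
    using ring_with_half_mobi_to_ring ring_module_space_to_module
    by (auto simp: S to_module_def module_objects_def extensional2_def mobi_to_ring_def
        space_to_module_def)
qed

lemma (in ring_with_half) mobi_two_ring_to_mobi: "mobi_two (ring_to_mobi R) = two"
proof -
  interpret A: mobi_algebra_with_two "ring_to_mobi R"
    by (rule mobi_algebra_with_two_ring_to_mobi)
  show ?thesis
    by (rule A.mobi_two_unique) simp_all
qed

text \<open>The midpoint halves a sum and \<open>mobi_two\<close>, which is \<open>two\<close> here,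
  doubles it again; with the zero element in first place a combination is a plain product or
  action.\<close>

lemma to_module_to_mobi:
  assumes "S \<in> module_objects"
  shows "to_module (to_mobi S) = S"
proof -
  obtain R X where S: "S = (R, X)"
    by (cases S)
  then interpret half_module R X
    using assms by (simp add: module_objects_imp_half_module)
  have unit: "\<one>\<^bsub>X\<^esub> \<in> carrier X"
    by simp
  have unit_mult: "\<one>\<^bsub>X\<^esub> \<otimes>\<^bsub>X\<^esub> x = x" if "x \<in> carrier X" for x
    using that by simp
  have ext: "extensional2 (carrier R) (carrier R) (monoid.mult R)"
      "extensional2 (carrier R) (carrier R) (add R)"
      "extensional2 (carrier X) (carrier X) (monoid.mult X)"
      "act X \<in> extensional (carrier R)"
    using assms by (simp_all add: S module_objects_def)
  \<comment> \<open>This covers points outside the carrier of \<open>X\<close>, where the inner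
    restriction in \<open>space_to_module\<close> also yields \<open>undefined\<close>.\<close>
  have act_ext: "act X a \<in> extensional (carrier X)" if "a \<in> carrier R" for a
    using that act_ring_hom by (auto simp: ring_hom_def End_ring_def)
  have add: "two \<otimes>\<^bsub>R\<^esub> (half \<otimes>\<^bsub>R\<^esub> a \<oplus>\<^bsub>R\<^esub> half \<otimes>\<^bsub>R\<^esub> b) = a \<oplus>\<^bsub>R\<^esub> b"
    if "a \<in> carrier R" "b \<in> carrier R" for a b
    using that two_half_mult[of "a \<oplus>\<^bsub>R\<^esub> b"] by (simp add: r_distr)
  have plus: "act X two (act X half x \<otimes>\<^bsub>X\<^esub> act X half y) = x \<otimes>\<^bsub>X\<^esub> y"
    if "x \<in> carrier X" "y \<in> carrier X" for x y
    using that by (simp add: act_distr)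
  have "mobi_to_ring (ring_to_mobi R) = R"
  proof (rule ring.equality)
    show "monoid.mult (mobi_to_ring (ring_to_mobi R)) = monoid.mult R"
      using ext(1) by (auto simp: mobi_to_ring_def extensional2_def fun_eq_iff)
    show "add (mobi_to_ring (ring_to_mobi R)) = add R"
      using ext(2) by (auto simp: mobi_to_ring_def extensional2_def fun_eq_iff mobi_two_ring_to_mobi add)
  qed simp_all
  moreover have "space_to_module (ring_to_mobi R) (module_to_space R X) = X"
  proof (rule rmodule.equality)
    show "monoid.mult (space_to_module (ring_to_mobi R) (module_to_space R X)) = monoid.mult X"
      using ext(3)
      by (auto simp: space_to_module_def extensional2_def fun_eq_iff mobi_two_ring_to_mobi plus unit)
    have "act (space_to_module (ring_to_mobi R) (module_to_space R X)) a x = act X a x" for a x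
      using ext(4) act_ext[of a]
      by (auto simp: space_to_module_def unit unit_mult extensional_def)
    then show "act (space_to_module (ring_to_mobi R) (module_to_space R X)) = act X"
      by (simp add: fun_eq_iff)
  qed simp_all
  ultimately show ?thesis
    by (simp add: S to_module_def to_mobi_def)
qed

text \<open>On carriers both operations are recovered by \<open>sop_eq_plus\<close>, for the regular
  space and for \<open>X\<close>, with \<open>one_minus\<close> translating the complement.
  Elsewhere \<open>extensional3\<close> fixes the value.\<close>

lemma to_mobi_to_module:
  assumes "S \<in> pointed_affine_mobi_objects"
  shows "to_mobi (to_module S) = S"
proof -
  obtain A X where S: "S = (A, X)"
    by (cases S)
  then interpret pointed_affine_mobi_space A X
    using assms by (simp add: pointed_affine_mobi_objects_imp_space)
  interpret reg: pointed_affine_mobi_space A "regular_space A"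
    by (rule pointed_affine_mobi_space_regular)
  have ext: "extensional3 (carrier A) (carrier A) (carrier A) (mop A)"
    "extensional3 (carrier X) (carrier A) (carrier X) (sop X)"
    using assms by (simp_all add: S pointed_affine_mobi_objects_def)
  have "ring_to_mobi (mobi_to_ring A) = A"
  proof (rule mobi_algebra.equality)
    have "mop (ring_to_mobi (mobi_to_ring A)) a b c = mop A a b c" for a b c
    proof (cases "a \<in> carrier A \<and> b \<in> carrier A \<and> c \<in> carrier A")
      case True
      then show ?thesis
        using reg.sop_eq_plus[of a b c] one_minus[of b]
        by (simp add: closed) (simp add: reg.plus_def reg.scal_def reg.mid_def)
    next
      case False
      then show ?thesis
        using ext(1) by (auto simp: ring_to_mobi_def extensional3_def)
    qed
    then show "mop (ring_to_mobi (mobi_to_ring A)) = mop A"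
      by (simp add: fun_eq_iff)
    show "mhalf (ring_to_mobi (mobi_to_ring A)) = mhalf A"
      by (simp only: ring_to_mobi_simps one_add_one inv_two)
  qed simp_all
  moreover have "module_to_space (mobi_to_ring A) (space_to_module A X) = X"
  proof (rule pointed_mobi_space.equality)
    have "sop (module_to_space (mobi_to_ring A) (space_to_module A X)) x a y = sop X x a y" for x a y
    proof (cases "x \<in> carrier X \<and> a \<in> carrier A \<and> y \<in> carrier X")
      case True
      then show ?thesis
        using sop_eq_plus[of x a y] one_minus[of a]
        by (simp add: closed_space space_to_module_plus space_to_module_act
            del: space_to_module_simps(3,4))
    next
      case False
      then show ?thesis
        using ext(2) by (auto simp: module_to_space_def extensional3_def)
    qed
    then show "sop (module_to_space (mobi_to_ring A) (space_to_module A X)) = sop X"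
      by (simp add: fun_eq_iff)
  qed simp_all
  ultimately show ?thesis
    by (simp add: S to_module_def to_mobi_def)
qed

section \<open>The correspondence of morphisms\<close>

lemma to_mobi_hom:
  assumes "S \<in> module_objects" "T \<in> module_objects"
  shows "module_hom S T \<subseteq> pointed_affine_mobi_hom (to_mobi S) (to_mobi T)"
proof
  fix h assume h: "h \<in> module_hom S T"
  obtain R X R' X' f g where S: "S = (R, X)" "T = (R', X')" "h = (f, g)"
    by (metis surj_pair)
  interpret S: half_module R X
    using assms(1) by (simp add: module_objects_imp_half_module S)
  interpret T: half_module R' X'
    using assms(2) by (simp add: module_objects_imp_half_module S)
  have f: "f \<in> ring_hom R R'" "f \<in> extensional (carrier R)"
    and g: "g \<in> carrier X \<rightarrow>\<^sub>E carrier X'" "g \<one>\<^bsub>X\<^esub> = \<one>\<^bsub>X'\<^esub>"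
      "\<And>x y. \<lbrakk>x \<in> carrier X; y \<in> carrier X\<rbrakk> \<Longrightarrow> g (x \<otimes>\<^bsub>X\<^esub> y) = g x \<otimes>\<^bsub>X'\<^esub> g y"
      "\<And>a x. \<lbrakk>a \<in> carrier R; x \<in> carrier X\<rbrakk> \<Longrightarrow> g (act X a x) = act X' (f a) (g x)"
    using h by (auto simp: S module_hom_def)
  note f_simps = ring_hom_closed[OF f(1)] ring_hom_add[OF f(1)] ring_hom_mult[OF f(1)]
    ring_hom_one[OF f(1)]
  have f_zero: "f \<zero>\<^bsub>R\<^esub> = \<zero>\<^bsub>R'\<^esub>"
    by (rule ring_hom_zero[OF f(1)]) unfold_locales
  have minus: "f (\<one>\<^bsub>R\<^esub> \<ominus>\<^bsub>R\<^esub> a) = \<one>\<^bsub>R'\<^esub> \<ominus>\<^bsub>R'\<^esub> f a" if "a \<in> carrier R" for a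
  proof (rule T.add_eq_imp_minus_eq[symmetric])
    show "f (\<one>\<^bsub>R\<^esub> \<ominus>\<^bsub>R\<^esub> a) \<oplus>\<^bsub>R'\<^esub> f a = \<one>\<^bsub>R'\<^esub>"
      using that f_simps(2)[of "\<one>\<^bsub>R\<^esub> \<ominus>\<^bsub>R\<^esub> a" a] by (simp add: S.minus_add_cancel f_simps(4))
  qed (use that in \<open>simp_all add: f_simps\<close>)
  \<comment> \<open>The image of \<open>S.half\<close> is a two-sided inverse of
    \<open>T.two\<close>, because \<open>f\<close> preserves one, sums and products; inverses are
    unique.\<close>
  have half: "f S.half = T.half"
  proof (rule T.half_unique)
    have two: "T.two = f S.two"
      by (simp add: f_simps)
    show "T.two \<otimes>\<^bsub>R'\<^esub> f S.half = \<one>\<^bsub>R'\<^esub>" "f S.half \<otimes>\<^bsub>R'\<^esub> T.two = \<one>\<^bsub>R'\<^esub>"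
      unfolding two by (simp_all add: f_simps(3)[symmetric] f_simps(4))
  qed (simp_all add: f_simps)
  show "h \<in> pointed_affine_mobi_hom (to_mobi S) (to_mobi T)"
    using f(2) g by (auto simp: S to_mobi_def pointed_affine_mobi_hom_def mobi_algebra_hom_def
        minus half f_zero f_simps PiE_iff)
qed

lemma to_module_hom:
  assumes "S \<in> pointed_affine_mobi_objects" "T \<in> pointed_affine_mobi_objects"
  shows "pointed_affine_mobi_hom S T \<subseteq> module_hom (to_module S) (to_module T)"
proof
  fix h assume h: "h \<in> pointed_affine_mobi_hom S T"
  obtain A X A' X' f g where S: "S = (A, X)" "T = (A', X')" "h = (f, g)"
    by (metis surj_pair)
  interpret S: pointed_affine_mobi_space A X
    using assms(1) by (simp add: pointed_affine_mobi_objects_imp_space S)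
  interpret T: pointed_affine_mobi_space A' X'
    using assms(2) by (simp add: pointed_affine_mobi_objects_imp_space S)
  have f: "f \<in> mobi_algebra_hom A A'" "f \<in> extensional (carrier A)"
    and g: "g \<in> carrier X \<rightarrow>\<^sub>E carrier X'" "g (origin X) = origin X'"
      "\<And>x a y. \<lbrakk>x \<in> carrier X; a \<in> carrier A; y \<in> carrier X\<rbrakk>
        \<Longrightarrow> g (sop X x a y) = sop X' (g x) (f a) (g y)"
    using h by (auto simp: S pointed_affine_mobi_hom_def)
  have f_closed: "f a \<in> carrier A'" if "a \<in> carrier A" for a
    using that f by (auto simp: mobi_algebra_hom_def)
  have g_closed: "g x \<in> carrier X'" if "x \<in> carrier X" for x
    using that g by auto
  have f_mop: "f (mop A a b c) = mop A' (f a) (f b) (f c)"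
    if "a \<in> carrier A" "b \<in> carrier A" "c \<in> carrier A" for a b c
    using that f by (auto simp: mobi_algebra_hom_def)
  have f_const: "f (mzero A) = mzero A'" "f (mhalf A) = mhalf A'" "f (mone A) = mone A'"
    using f by (auto simp: mobi_algebra_hom_def)
  \<comment> \<open>Preservation of 2 is derived: the image satisfies the equation that determines
    \<open>mobi_two A'\<close>. Sums involve 2, so their preservation rests on this.\<close>
  have "mobi_two A' = f (mobi_two A)"
  proof (rule T.mobi_two_unique)
    show "mop A' (mzero A') (mhalf A') (f (mobi_two A)) = mone A'"
      using f_mop[of "mzero A" "mhalf A" "mobi_two A"] by (simp add: f_const S.closed S.half_mobi_two)
  qed (simp add: f_closed S.closed)
  then show "h \<in> module_hom (to_module S) (to_module T)"
    using f(2) g(1,2)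
    by (auto simp: S to_module_def module_hom_def f_closed g_closed f_mop g(3) f_const S.closed_space
        intro!: ring_hom_memI)
qed

theorem theorem6p1:
  "isomorphic_categories
    (module_category ::
      ('a ring \<times> ('a, 'x) rmodule,
       ('a ring \<times> ('a, 'x) rmodule, ('a \<Rightarrow> 'a) \<times> ('x \<Rightarrow> 'x)) arrow) category_data)
    (pointed_affine_mobi_category ::
      ('a mobi_algebra \<times> ('a, 'x) pointed_mobi_space,
       ('a mobi_algebra \<times> ('a, 'x) pointed_mobi_space, ('a \<Rightarrow> 'a) \<times> ('x \<Rightarrow> 'x)) arrow) category_data)"
  unfolding module_category_def pointed_affine_mobi_category_def
proof (rule isomorphic_pair_categories[where F = to_mobi and G = to_module])
qed (simp_all add: pair_category_module pair_category_pointed_affine_mobi to_mobi_object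
    to_module_object to_module_to_mobi to_mobi_to_module to_mobi_hom to_module_hom,
    auto simp: to_mobi_def to_module_def)

end
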